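(* Let $(N_1,\dots,N_r;F)$ generate a nilpotent orbit of pure polarized Hodge structure of weight $w$, with associated several variable $SL_2$-orbit data $(\hat N_j^-,H_j,\hat N_j^+)$, $1\le j\le r$, and $G_{\mathbb R}$-valued function $g(y)$. Put $N(y)=\sum_jy_jN_j$ and $H_{(r)}=H_1+\cdots+H_r$. Then for $y_1/y_2,\dots,y_r/y_{r+1}$ sufficiently large (with $y_{r+1}=1$) the $sl_2$-triple associated with the one-variable nilpotent orbit generated by $(N(y),F)$ is $$(N(y),\,H_{(r)},\,N^+(y)),\qquad N^+(y)=\mathrm{Ad}(g(y))\sum_{j=1}^r\frac1{y_j}\hat N_j^+ .$$
   Context: $\mathcal D$ is a classifying space of pure Hodge structures of weight $w$ on a real vector space polarized by a form $Q$, $\check{\mathcal D}$ its compact dual, $G_{\mathbb R}=\mathrm{Aut}_{\mathbb R}(Q)$, $\mathfrak g_{\mathbb R}=\mathrm{Lie}(G_{\mathbb R})$. $(N_1,\dots,N_r;F)$ generates a nilpotent orbit if the $N_j\in\mathfrak g_{\mathbb R}$ are commuting nilpotent elements, $F\in\check{\mathcal D}$, $N_jF^p\subseteq F^{p-1}$ and $e^{\sum_jz_jN_j}.F\in\mathcal D$ for all $\mathrm{Im}(z_j)$ sufficiently large. An $sl_2$-triple $(N^-,H,N^+)$ satisfies $[N^+,N^-]=H$, $[H,N^\pm]=\pm2N^\pm$. The several variable $SL_2$-orbit theorem (Cattani–Kaplan–Schmid) attaches to the nilpotent orbit commuting $sl_2$-triples $(\hat N_j^-,H_j,\hat N_j^+)$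 in $\mathfrak g_{\mathbb R}$, $1\le j\le r$ (the images of the standard generators under a representation of $SL_2(\mathbb R)^r$), and $G_{\mathbb R}$-valued functions $g_j(y_1/y_{j+1},\dots,y_j/y_{j+1})$, $1\le j\le r-1$, defined for $y_1/y_2,\dots,y_r/y_{r+1}$ sufficiently large. The product $g(y)=\prod_{j=1}^{r-1}g_j(y_1/y_{j+1},\dots,y_j/y_{j+1})$ commutes with $H_{(r)}$ and satisfies $N(y)=\mathrm{Ad}(g(y))\sum_jy_j\hat N_j^-$. For $N$ in the open cone of positive combinations of the $N_j$, $W(N)[-w]$ is the monodromy weight filtration of $N$ recentred at $w$; it is independent of $N$, and $(F,W(N)[-w])$ is a mixed Hodge structure, with canonical ($sl_2$-) splitting $(\hat F,W(N)[-w])=(e^{-\epsilon}.F,W(N)[-w])$ over $\mathbb R$ in the sense of Cattani–Kaplan–Schmid. The $sl_2$-triple associated with the one-variable nilpotent orbit generated by $(N(y),F)$ is the triple $(N(y),H,N^+)$ in which $H$ acts as multiplication by $p+q-w$ on the Deligne component $I^{p,q}_{(\hat F,W(N)[-w])}$; this $H$ coincides with $H_{(r)}$. *)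

theory Defs
  imports "HOL-Analysis.Analysis" "HOL-Computational_Algebra.Polynomial"
begin

text \<open>
  The real vector space is \<open>real ^ 'n\<close>, its complexification is \<open>complex ^ 'n\<close>. Filtrations are
  families of complex subspaces indexed by \<open>int\<close>; Hodge filtrations are decreasing, weight
  filtrations increasing. Elements of $\mathfrak{g}_{\mathbb R}$ and $G_{\mathbb R}$ are real
  matrices, so reality is expressed by the type. Products of matrices are written \<open>**\<close>; the
  library's \<open>*\<close>, \<open>^\<close> and \<open>exp\<close> are not the matrix operations.
\<close>

section \<open>Matrices\<close>

definition cvec :: "complex ^ 'n \<Rightarrow> complex ^ 'n" where
  "cvec v = (\<chi> i. cnj (v $ i))"

definition cmat :: "real ^ 'n ^ 'n \<Rightarrow> complex ^ 'n ^ 'n" where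
  "cmat A = map_matrix complex_of_real A"

definition mscale :: "complex \<Rightarrow> complex ^ 'n ^ 'n \<Rightarrow> complex ^ 'n ^ 'n" where
  "mscale c A = map_matrix (\<lambda>x. c * x) A"

primrec mpow :: "('a::semiring_1) ^ 'n ^ 'n \<Rightarrow> nat \<Rightarrow> 'a ^ 'n ^ 'n" where
  "mpow A 0 = mat 1"
| "mpow A (Suc k) = A ** mpow A k"

definition mexp :: "complex ^ 'n ^ 'n \<Rightarrow> complex ^ 'n ^ 'n" where
  "mexp A = (\<Sum>k. (1 / fact k) *\<^sub>R mpow A k)"

definition mnilpotent :: "('a::semiring_1) ^ 'n ^ 'n \<Rightarrow> bool" where
  "mnilpotent A \<longleftrightarrow> (\<exists>k. mpow A k = 0)"

definition lie :: "('a::ring_1) ^ 'n ^ 'n \<Rightarrow> 'a ^ 'n ^ 'n \<Rightarrow> 'a ^ 'n ^ 'n" where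
  "lie A B = A ** B - B ** A"

definition Ad :: "real ^ 'n ^ 'n \<Rightarrow> real ^ 'n ^ 'n \<Rightarrow> real ^ 'n ^ 'n" where
  "Ad g X = g ** X ** matrix_inv g"

definition act :: "complex ^ 'n ^ 'n \<Rightarrow> (int \<Rightarrow> (complex ^ 'n) set) \<Rightarrow> int \<Rightarrow> (complex ^ 'n) set" where
  "act A F p = (\<lambda>v. A *v v) ` F p"

section \<open>Polarizing form, classifying space, nilpotent orbits\<close>

text \<open>The form is given by its Gram matrix.\<close>

definition polarizing_form :: "int \<Rightarrow> real ^ 'n ^ 'n \<Rightarrow> bool" where
  "polarizing_form w Q \<longleftrightarrow> invertible Q \<and> transpose Q = (if even w then Q else - Q)"

definition Qform :: "real ^ 'n ^ 'n \<Rightarrow> complex ^ 'n \<Rightarrow> complex ^ 'n \<Rightarrow> complex" where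
  "Qform Q u v = (\<Sum>i\<in>UNIV. \<Sum>j\<in>UNIV. u $ i * complex_of_real (Q $ i $ j) * v $ j)"

definition G_real :: "real ^ 'n ^ 'n \<Rightarrow> (real ^ 'n ^ 'n) set" where
  "G_real Q = {g. invertible g \<and> transpose g ** Q ** g = Q}"

definition g_real :: "real ^ 'n ^ 'n \<Rightarrow> (real ^ 'n ^ 'n) set" where
  "g_real Q = {X. transpose X ** Q + Q ** X = 0}"

definition decreasing_filtration :: "(int \<Rightarrow> (complex ^ 'n) set) \<Rightarrow> bool" where
  "decreasing_filtration F \<longleftrightarrow>
     (\<forall>p. vec.subspace (F p)) \<and> antimono F \<and> (\<exists>p. F p = UNIV) \<and> (\<exists>p. F p = {0})"

definition increasing_filtration :: "(int \<Rightarrow> (complex ^ 'n) set) \<Rightarrow> bool" where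
  "increasing_filtration W \<longleftrightarrow>
     (\<forall>k. vec.subspace (W k)) \<and> mono W \<and> (\<exists>k. W k = {0}) \<and> (\<exists>k. W k = UNIV)"

text \<open>
  \<open>h p\<close> is the Hodge number $h^{p,w-p}$. In the compact dual only the first bilinear relation is
  imposed.
\<close>

definition compact_dual ::
    "int \<Rightarrow> real ^ 'n ^ 'n \<Rightarrow> (int \<Rightarrow> nat) \<Rightarrow> (int \<Rightarrow> (complex ^ 'n) set) set" where
  "compact_dual w Q h = {F. decreasing_filtration F \<and>
     (\<forall>p. vec.dim (F p) = (\<Sum>q | p \<le> q \<and> h q \<noteq> 0. h q)) \<and>
     (\<forall>p. \<forall>u\<in>F p. \<forall>v\<in>F (w - p + 1). Qform Q u v = 0)}"

definition classifying_space ::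
    "int \<Rightarrow> real ^ 'n ^ 'n \<Rightarrow> (int \<Rightarrow> nat) \<Rightarrow> (int \<Rightarrow> (complex ^ 'n) set) set" where
  "classifying_space w Q h = {F \<in> compact_dual w Q h.
     (\<forall>p. F p + cvec ` F (w - p + 1) = UNIV \<and> F p \<inter> cvec ` F (w - p + 1) = {0}) \<and>
     (\<forall>p. \<forall>v\<in>F p \<inter> cvec ` F (w - p). v \<noteq> 0 \<longrightarrow>
        \<i> powi (p - (w - p)) * Qform Q v (cvec v) \<in> \<real> \<and>
        0 < Re (\<i> powi (p - (w - p)) * Qform Q v (cvec v)))}"

definition nilpotent_orbit ::
    "int \<Rightarrow> real ^ 'n ^ 'n \<Rightarrow> (int \<Rightarrow> nat) \<Rightarrow> nat \<Rightarrow> (nat \<Rightarrow> real ^ 'n ^ 'n)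
      \<Rightarrow> (int \<Rightarrow> (complex ^ 'n) set) \<Rightarrow> bool" where
  "nilpotent_orbit w Q h r N F \<longleftrightarrow>
     1 \<le> r \<and>
     (\<forall>j\<in>{1..r}. N j \<in> g_real Q \<and> mnilpotent (N j)) \<and>
     (\<forall>j\<in>{1..r}. \<forall>k\<in>{1..r}. lie (N j) (N k) = 0) \<and>
     F \<in> compact_dual w Q h \<and>
     (\<forall>j\<in>{1..r}. \<forall>p. (\<lambda>v. cmat (N j) *v v) ` F p \<subseteq> F (p - 1)) \<and>
     (\<exists>c. \<forall>z. (\<forall>j\<in>{1..r}. c < Im (z j)) \<longrightarrow>
        act (mexp (\<Sum>j=1..r. mscale (z j) (cmat (N j)))) F \<in> classifying_space w Q h)"

section \<open>Weight filtrations and mixed Hodge structures\<close>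

text \<open>
  The last two conditions say that $N^k : \mathrm{Gr}_k \to \mathrm{Gr}_{-k}$ is injective and
  surjective.
\<close>

definition is_monodromy_weight_filtration ::
    "complex ^ 'n ^ 'n \<Rightarrow> (int \<Rightarrow> (complex ^ 'n) set) \<Rightarrow> bool" where
  "is_monodromy_weight_filtration N W \<longleftrightarrow>
     increasing_filtration W \<and>
     (\<forall>k. (\<lambda>v. N *v v) ` W k \<subseteq> W (k - 2)) \<and>
     (\<forall>k::nat. \<forall>v\<in>W (int k). mpow N k *v v \<in> W (- int k - 1) \<longrightarrow> v \<in> W (int k - 1)) \<and>
     (\<forall>k::nat. \<forall>u\<in>W (- int k). \<exists>v\<in>W (int k). u - mpow N k *v v \<in> W (- int k - 1))"

definition monodromy_weight_filtration :: "complex ^ 'n ^ 'n \<Rightarrow> int \<Rightarrow> (complex ^ 'n) set" where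
  "monodromy_weight_filtration N = (THE W. is_monodromy_weight_filtration N W)"

text \<open>$W(N)[-w]$, the monodromy weight filtration recentred at \<open>w\<close>.\<close>

definition shifted_weight :: "int \<Rightarrow> real ^ 'n ^ 'n \<Rightarrow> int \<Rightarrow> (complex ^ 'n) set" where
  "shifted_weight w N k = monodromy_weight_filtration (cmat N) (k - w)"

text \<open>
  The last condition says that \<open>F\<close> induces on each $\mathrm{Gr}^W_k$ a pure Hodge structure of
  weight \<open>k\<close>, i.e. $\mathrm{Gr}^W_k = F^p \oplus \overline{F^{k-p+1}}$ for all \<open>p\<close>.
\<close>

definition mixed_hodge_structure ::
    "(int \<Rightarrow> (complex ^ 'n) set) \<Rightarrow> (int \<Rightarrow> (complex ^ 'n) set) \<Rightarrow> bool" where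
  "mixed_hodge_structure F W \<longleftrightarrow>
     decreasing_filtration F \<and> increasing_filtration W \<and> (\<forall>k. cvec ` W k = W k) \<and>
     (\<forall>k p.
        (F p \<inter> W k) + (cvec ` F (k - p + 1) \<inter> W k) + W (k - 1) = W k \<and>
        ((F p \<inter> W k) + W (k - 1)) \<inter> ((cvec ` F (k - p + 1) \<inter> W k) + W (k - 1)) = W (k - 1))"

text \<open>The Deligne component $I^{p,q}_{(F,W)}$.\<close>

definition deligne ::
    "(int \<Rightarrow> (complex ^ 'n) set) \<Rightarrow> (int \<Rightarrow> (complex ^ 'n) set) \<Rightarrow> int \<Rightarrow> int
      \<Rightarrow> (complex ^ 'n) set" where
  "deligne F W p q = F p \<inter> W (p + q) \<inter>
     ((cvec ` F q \<inter> W (p + q)) +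
      vec.span (\<Union>j::nat. cvec ` F (q - 1 - int j) \<inter> W (p + q - 2 - int j)))"

definition splits_over_reals ::
    "(int \<Rightarrow> (complex ^ 'n) set) \<Rightarrow> (int \<Rightarrow> (complex ^ 'n) set) \<Rightarrow> bool" where
  "splits_over_reals F W \<longleftrightarrow>
     mixed_hodge_structure F W \<and> (\<forall>p q. cvec ` deligne F W p q = deligne F W q p)"

section \<open>The canonical splitting of Cattani, Kaplan and Schmid\<close>

text \<open>The algebra $L^{-1,-1}$ and the Hodge components of an endomorphism, for a bigrading \<open>I\<close>.\<close>

definition L_minus ::
    "(int \<Rightarrow> int \<Rightarrow> (complex ^ 'n) set) \<Rightarrow> (complex ^ 'n ^ 'n) set" where
  "L_minus I = {X. \<forall>p q. \<forall>v\<in>I p q. X *v v \<in> vec.span (\<Union>{I a b |a b. a < p \<and> b < q})}"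

definition hodge_component ::
    "(int \<Rightarrow> int \<Rightarrow> (complex ^ 'n) set) \<Rightarrow> int \<Rightarrow> int \<Rightarrow> complex ^ 'n ^ 'n \<Rightarrow> complex ^ 'n ^ 'n"
  where
  "hodge_component I a b X = (THE Y. \<forall>p q. \<forall>v\<in>I p q.
     Y *v v \<in> I (p + a) (q + b) \<and>
     X *v v - Y *v v \<in> vec.span (\<Union>{I c d |c d. (c, d) \<noteq> (p + a, q + b)}))"

text \<open>
  The universal formula for $\zeta$ in Cattani--Kaplan--Schmid, Lemma 6.60. The coefficients
  $b^k_{p,q}$ are given by $(1-x)^p(1+x)^q = \sum_k b^k_{p,q} x^k$, and the noncommutative
  polynomials $P_n(X_2,\dots,X_{n+1})$ by $P_0 = 1$ and
  $P_n = -\frac1n \sum_{k=1}^n P_{n-k} X_{k+1}$.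
\<close>

definition cks_b :: "nat \<Rightarrow> nat \<Rightarrow> nat \<Rightarrow> complex" where
  "cks_b k p q = coeff ([:1, -1:] ^ p * [:1, 1:] ^ q) k"

fun cks_P :: "(nat \<Rightarrow> complex ^ 'n ^ 'n) \<Rightarrow> nat \<Rightarrow> complex ^ 'n ^ 'n" where
  "cks_P X 0 = mat 1"
| "cks_P X (Suc n) =
     mscale (- 1 / of_nat (Suc n)) (\<Sum>k\<in>{1..Suc n}. cks_P X (Suc n - k) ** X (k + 1))"

text \<open>
  $C_l(\eta) = i \sum_{p,q\ge1} b^{l-2}_{p-1,q-1}\, \eta_{-p,-q}$ for $l \ge 2$; the sum ranges
  over the finitely many nonzero components.
\<close>

definition cks_C ::
    "(int \<Rightarrow> int \<Rightarrow> (complex ^ 'n) set) \<Rightarrow> complex ^ 'n ^ 'n \<Rightarrow> nat \<Rightarrow> complex ^ 'n ^ 'n" where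
  "cks_C I \<eta> l = mscale \<i>
     (\<Sum>(p, q) \<in> {(p, q). 1 \<le> p \<and> 1 \<le> q \<and> hodge_component I (- int p) (- int q) \<eta> \<noteq> 0}.
        mscale (cks_b (l - 2) (p - 1) (q - 1)) (hodge_component I (- int p) (- int q) \<eta>))"

text \<open>
  \<open>Fh\<close> is the canonical ($sl_2$-) splitting of the mixed Hodge structure \<open>(F, W)\<close>. First
  $\tilde F = e^{-i\delta}.F$ is Deligne's splitting, $\delta$ being the unique real element of
  $L^{-1,-1}_{(F,W)}$ for which $(\tilde F, W)$ splits over the reals. Then $\zeta$ (together with
  $\eta$) is the unique real solution in $L^{-1,-1}_{(\tilde F,W)}$ of
  $e^{i\delta} = e^{\zeta}\bigl(1 + \sum_{k\ge1} P_k(C_2(\eta),\dots,C_{k+1}(\eta))\bigr)$, with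
  components taken with respect to $(\tilde F, W)$, and
  $\hat F = e^{\zeta}.\tilde F = e^{-\epsilon}.F$ where $e^{-\epsilon} = e^{\zeta}e^{-i\delta}$.
  Note that $(\hat F, W)$ is a mixed Hodge structure split over the reals as well.
\<close>

definition canonical_splitting ::
    "(int \<Rightarrow> (complex ^ 'n) set) \<Rightarrow> (int \<Rightarrow> (complex ^ 'n) set) \<Rightarrow> (int \<Rightarrow> (complex ^ 'n) set)
      \<Rightarrow> bool" where
  "canonical_splitting F W Fh \<longleftrightarrow>
     mixed_hodge_structure F W \<and> splits_over_reals Fh W \<and>
     (\<exists>(\<delta> :: real ^ 'n ^ 'n) (\<zeta> :: real ^ 'n ^ 'n) (\<eta> :: real ^ 'n ^ 'n) Ft I.
        cmat \<delta> \<in> L_minus (deligne F W) \<and>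
        Ft = act (mexp (mscale (- \<i>) (cmat \<delta>))) F \<and> splits_over_reals Ft W \<and>
        I = deligne Ft W \<and> cmat \<zeta> \<in> L_minus I \<and> cmat \<eta> \<in> L_minus I \<and>
        mexp (mscale \<i> (cmat \<delta>)) = mexp (cmat \<zeta>) ** (\<Sum>k. cks_P (cks_C I (cmat \<eta>)) k) \<and>
        Fh = act (mexp (cmat \<zeta>)) Ft)"

section \<open>Data of the several variable $SL_2$-orbit theorem\<close>

definition sl2_triple ::
    "real ^ 'n ^ 'n \<Rightarrow> real ^ 'n ^ 'n \<Rightarrow> real ^ 'n ^ 'n \<Rightarrow> bool" where
  "sl2_triple Nm H Np \<longleftrightarrow>
     lie Np Nm = H \<and> lie H Np = 2 *\<^sub>R Np \<and> lie H Nm = (- 2) *\<^sub>R Nm"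

definition weight_grading ::
    "int \<Rightarrow> (int \<Rightarrow> (complex ^ 'n) set) \<Rightarrow> (int \<Rightarrow> (complex ^ 'n) set) \<Rightarrow> real ^ 'n ^ 'n \<Rightarrow> bool"
  where
  "weight_grading w F W H \<longleftrightarrow>
     (\<forall>p q. \<forall>v\<in>deligne F W p q. cmat H *v v = of_int (p + q - w) *s v)"

text \<open>\<open>X0\<close> is the component of \<open>X\<close> in the zero eigenspace of \<open>ad H\<close> (with integral eigenvalues).\<close>

definition ad_zero_component ::
    "real ^ 'n ^ 'n \<Rightarrow> real ^ 'n ^ 'n \<Rightarrow> real ^ 'n ^ 'n \<Rightarrow> bool" where
  "ad_zero_component H X X0 \<longleftrightarrow>
     (\<exists>M :: int \<Rightarrow> real ^ 'n ^ 'n. finite {l. M l \<noteq> 0} \<and>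
        (\<forall>l. lie H (M l) = of_int l *\<^sub>R M l) \<and> X = (\<Sum>l | M l \<noteq> 0. M l) \<and> X0 = M 0)"

definition partial_sum :: "(nat \<Rightarrow> real ^ 'n ^ 'n) \<Rightarrow> nat \<Rightarrow> real ^ 'n ^ 'n" where
  "partial_sum X j = (\<Sum>k=1..j. X k)"

definition ratios_exceed :: "nat \<Rightarrow> real \<Rightarrow> (nat \<Rightarrow> real) \<Rightarrow> bool" where
  "ratios_exceed r c y \<longleftrightarrow> y (r + 1) = 1 \<and> (\<forall>j\<in>{1..r}. c < y j / y (j + 1))"

text \<open>
  $g_m \cdots g_1$ with $g_j$ evaluated at $(y_1/y_{j+1},\dots,y_j/y_{j+1})$. As in
  Cattani--Kaplan--Schmid the factors with larger index stand on the left.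
\<close>

primrec g_prod ::
    "(nat \<Rightarrow> (nat \<Rightarrow> real) \<Rightarrow> real ^ 'n ^ 'n) \<Rightarrow> (nat \<Rightarrow> real) \<Rightarrow> nat \<Rightarrow> real ^ 'n ^ 'n" where
  "g_prod g y 0 = mat 1"
| "g_prod g y (Suc m) = g (Suc m) (\<lambda>k\<in>{1..Suc m}. y k / y (Suc m + 1)) ** g_prod g y m"

text \<open>
  The data attached by Cattani--Kaplan--Schmid to the nilpotent orbit generated by
  \<open>(N 1, \<dots>, N r; F)\<close>. With $W^j = W(N_1+\dots+N_j)[-w]$ put $F_r = F$ and, descending,
  let $(\hat F_j, W^j)$ be the canonical splitting of $(F_j, W^j)$ and
  $F_{j-1} = e^{iN_j}.\hat F_j$. Then $H_{(j)} = H_1+\dots+H_j$ is the grading of $W^j$ defined by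
  $\hat F_j$, and $\hat N_j^-$ is the component of $N_j$ in the zero eigenspace of
  $\mathrm{ad}\, H_{(j-1)}$. Together with $\hat N_j^+$ these form commuting $sl_2$-triples in
  $\mathfrak{g}_{\mathbb R}$. Of the functions $g_j$ only the stated properties are
  required; any $g_j$ possessing them is admitted.
\<close>

definition sl2_orbit_data ::
    "int \<Rightarrow> real ^ 'n ^ 'n \<Rightarrow> nat \<Rightarrow> (nat \<Rightarrow> real ^ 'n ^ 'n) \<Rightarrow> (int \<Rightarrow> (complex ^ 'n) set)
      \<Rightarrow> (nat \<Rightarrow> real ^ 'n ^ 'n) \<Rightarrow> (nat \<Rightarrow> real ^ 'n ^ 'n) \<Rightarrow> (nat \<Rightarrow> real ^ 'n ^ 'n)
      \<Rightarrow> (nat \<Rightarrow> (nat \<Rightarrow> real) \<Rightarrow> real ^ 'n ^ 'n) \<Rightarrow> bool" where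
  "sl2_orbit_data w Q r N F Nm H Np g \<longleftrightarrow>
     (\<exists>Fj Fh :: nat \<Rightarrow> int \<Rightarrow> (complex ^ 'n) set.
        Fj r = F \<and>
        (\<forall>j\<in>{1..<r}. Fj j = act (mexp (mscale \<i> (cmat (N (j + 1))))) (Fh (j + 1))) \<and>
        (\<forall>j\<in>{1..r}. canonical_splitting (Fj j) (shifted_weight w (partial_sum N j)) (Fh j)) \<and>
        (\<forall>j\<in>{1..r}. weight_grading w (Fh j) (shifted_weight w (partial_sum N j))
                      (partial_sum H j))) \<and>
     (\<forall>j\<in>{1..r}. ad_zero_component (partial_sum H (j - 1)) (N j) (Nm j)) \<and>
     (\<forall>j\<in>{1..r}. {Nm j, H j, Np j} \<subseteq> g_real Q \<and> sl2_triple (Nm j) (H j) (Np j)) \<and>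
     (\<forall>j\<in>{1..r}. \<forall>k\<in>{1..r}. j \<noteq> k \<longrightarrow>
        (\<forall>X\<in>{Nm j, H j, Np j}. \<forall>Y\<in>{Nm k, H k, Np k}. lie X Y = 0)) \<and>
     (\<exists>c>0. \<forall>y. ratios_exceed r c y \<longrightarrow>
        (\<forall>j\<in>{1..<r}. g j (\<lambda>k\<in>{1..j}. y k / y (j + 1)) \<in> G_real Q) \<and>
        g_prod g y (r - 1) ** partial_sum H r = partial_sum H r ** g_prod g y (r - 1) \<and>
        (\<Sum>j=1..r. y j *\<^sub>R N j) = Ad (g_prod g y (r - 1)) (\<Sum>j=1..r. y j *\<^sub>R Nm j))"

text \<open>
  The triple \<open>(N, H, Np)\<close> associated with the one-variable nilpotent orbit generated by
  \<open>(N, F)\<close>: \<open>H\<close> is determined by the canonical splitting of $(F, W(N)[-w])$, and \<open>Np\<close> by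
  \<open>N\<close> and \<open>H\<close>.
\<close>

definition associated_sl2_triple ::
    "int \<Rightarrow> real ^ 'n ^ 'n \<Rightarrow> (int \<Rightarrow> nat) \<Rightarrow> real ^ 'n ^ 'n \<Rightarrow> (int \<Rightarrow> (complex ^ 'n) set)
      \<Rightarrow> (real ^ 'n ^ 'n) \<times> (real ^ 'n ^ 'n) \<times> (real ^ 'n ^ 'n) \<Rightarrow> bool" where
  "associated_sl2_triple w Q h N F = (\<lambda>(Nm, H, Np).
     nilpotent_orbit w Q h 1 (\<lambda>_. N) F \<and>
     Nm = N \<and> {Nm, H, Np} \<subseteq> g_real Q \<and> sl2_triple Nm H Np \<and>
     (\<exists>Fh. canonical_splitting F (shifted_weight w N) Fh \<and>
           weight_grading w Fh (shifted_weight w N) H))"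

end

(*
  By Deligne's bigrading of the mixed Hodge structure (Fh, W), the filtration W is the filtration
  by eigenspaces of H_(r). Conjugating the sum of the commuting triples (y_j Nm_j, H_j, Np_j / y_j)
  by g(y) gives an sl2-triple (N(y), H_(r), N^+(y)), so the same filtration is the monodromy weight
  filtration of N(y). Hence W(N(y)) = W(N_1 + ... + N_r), and the canonical splitting given by the
  orbit data is that of (F, W(N(y))[-w]).
*)

theory Submission
  imports Defs
begin

section \<open>Filtrations graded by the eigenspaces of a matrix\<close>

text \<open>Since \<open>monodromy_weight_filtration\<close> is a definite description, exhibiting a
  suitable filtration for N(y) says nothing until uniqueness is known. Uniqueness is proved for two
  arbitrary monodromy weight filtrations of one matrix: an inclusion that holds after a shift of the
  index is sharpened one degree at a time. The link between W and H_(r) is kept in a weak form: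
  modulo W_(k-1), every vector of W_k is an eigenvector of weight k. Lifting Hodge classes to
  Deligne components gives exactly this, and comparing eigenvalues recovers the eigenspaces. The
  same filtration supplies the nilpotency of N(y), and positivity of the y_j makes the one-variable
  orbit a restriction of the given one.\<close>

definition eigsp :: "complex ^ 'n ^ 'n \<Rightarrow> int \<Rightarrow> (complex ^ 'n) set" where
  "eigsp M l = {v. M *v v = of_int l *s v}"

lemma eigsp_subspace: "vec.subspace (eigsp M l)"
  by (auto simp: vec.subspace_def eigsp_def vec.add vec.scale algebra_simps)

lemma increasing_filtration_subspace: "increasing_filtration W \<Longrightarrow> vec.subspace (W k)"
  by (simp add: increasing_filtration_def)

lemma increasing_filtration_mono:
  "increasing_filtration W \<Longrightarrow> v \<in> W k \<Longrightarrow> k \<le> l \<Longrightarrow> v \<in> W l"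
  by (auto simp: increasing_filtration_def mono_def)

lemma increasing_filtration_zero_below:
  assumes "increasing_filtration W"
  obtains L where "\<And>k v. k \<le> L \<Longrightarrow> v \<in> W k \<Longrightarrow> v = 0"
proof -
  obtain L where L: "W L = {0}"
    using assms by (auto simp: increasing_filtration_def)
  show thesis
    by (rule that[of L]) (use L assms in \<open>auto dest: increasing_filtration_mono\<close>)
qed

lemma increasing_filtration_all_above:
  assumes "increasing_filtration W"
  obtains K where "\<And>k v. K \<le> k \<Longrightarrow> v \<in> W k"
proof -
  obtain K where K: "W K = UNIV"
    using assms by (auto simp: increasing_filtration_def)
  show thesis
    by (rule that[of K]) (use K assms in \<open>auto intro: increasing_filtration_mono[of W _ K]\<close>)
qed

text \<open>The index runs over all integers, but W vanishes from some L downwards. The induction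
  starts there, so its base case concerns only the zero vector.\<close>

lemma increasing_filtration_induct [consumes 2, case_names zero step]:
  fixes W :: "int \<Rightarrow> (complex ^ 'n) set"
  assumes W: "increasing_filtration W" and v: "v \<in> W k"
    and zero: "\<And>k. P k 0"
    and step: "\<And>k v. (\<And>u. u \<in> W (k - 1) \<Longrightarrow> P (k - 1) u) \<Longrightarrow> v \<in> W k \<Longrightarrow> P k v"
  shows "P k v"
proof -
  obtain L where L: "\<And>k v. k \<le> L \<Longrightarrow> v \<in> W k \<Longrightarrow> v = 0"
    using increasing_filtration_zero_below[OF W] by blast
  have "\<forall>v\<in>W (L + int n). P (L + int n) v" for n
  proof (induction n)
    case 0
    then show ?case using L zero by force
  next
    case (Suc n)
    then show ?case using step[of "L + int (Suc n)"] by auto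
  qed
  then have *: "\<And>v. v \<in> W (L + int (nat (k - L))) \<Longrightarrow> P (L + int (nat (k - L))) v"
    by blast
  show ?thesis
  proof (cases "k \<le> L")
    case True
    then show ?thesis using L[OF True v] zero by simp
  next
    case False
    then show ?thesis using * v by simp
  qed
qed

text \<open>Only the graded pieces are constrained: classes in W_k / W_(k-1) have representatives of
  weight k. That W_k is the sum of the eigenspaces of index at most k is a consequence.\<close>

definition graded_by :: "complex ^ 'n ^ 'n \<Rightarrow> (int \<Rightarrow> (complex ^ 'n) set) \<Rightarrow> bool" where
  "graded_by M W \<longleftrightarrow> increasing_filtration W \<and>
     (\<forall>k. \<forall>v\<in>W k. \<exists>e\<in>W k \<inter> eigsp M k. v - e \<in> W (k - 1))"

lemma graded_by_filtration: "graded_by M W \<Longrightarrow> increasing_filtration W"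
  by (simp add: graded_by_def)

lemma graded_by_split:
  assumes "graded_by M W" "v \<in> W k"
  obtains e u where "v = e + u" "e \<in> W k" "e \<in> eigsp M k" "u \<in> W (k - 1)"
proof -
  obtain e where "e \<in> W k \<inter> eigsp M k" "v - e \<in> W (k - 1)"
    using assms by (auto simp: graded_by_def)
  then show thesis
    by (intro that[of e "v - e"]) auto
qed

lemma graded_by_invariant:
  assumes "graded_by M W" "v \<in> W k"
  shows "M *v v \<in> W k"
  using graded_by_filtration[OF assms(1)] assms(2)
proof (induction k v rule: increasing_filtration_induct)
  case (zero k)
  then show ?case
    using increasing_filtration_subspace[OF graded_by_filtration[OF assms(1)]]
    by (simp add: vec.subspace_0)
next
  case (step k v)
  note sub = increasing_filtration_subspace[OF graded_by_filtration[OF assms(1)], of k]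
  obtain e u where *: "v = e + u" "e \<in> W k" "e \<in> eigsp M k" "u \<in> W (k - 1)"
    using graded_by_split[OF assms(1) step(2)] .
  have "M *v v = of_int k *s e + M *v u"
    using * by (simp add: vec.add eigsp_def)
  moreover have "M *v u \<in> W k"
    using step(1)[OF *(4)] increasing_filtration_mono[OF graded_by_filtration[OF assms(1)]]
    by fastforce
  ultimately show ?case
    using sub * by (simp add: vec.subspace_add vec.subspace_scale)
qed

text \<open>M acts on W_k / W_(k-1) as the scalar k, so an eigenvector for another eigenvalue has
  zero class there: (k - l) e = l u - M u.\<close>

lemma graded_by_eigsp_descend:
  assumes gr: "graded_by M W" and v: "v \<in> W k" "v \<in> eigsp M l" and "k \<noteq> l"
  shows "v \<in> W (k - 1)"
proof -
  note sub = increasing_filtration_subspace[OF graded_by_filtration[OF gr], of "k - 1"]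
  obtain e u where *: "v = e + u" "e \<in> W k" "e \<in> eigsp M k" "u \<in> W (k - 1)"
    using graded_by_split[OF gr v(1)] .
  have "of_int k *s e + M *v u = of_int l *s e + of_int l *s u"
    using v(2) * by (simp add: eigsp_def vec.add algebra_simps)
  then have "of_int (k - l) *s e = of_int l *s u - M *v u"
    by (simp add: algebra_simps)
  also have "\<dots> \<in> W (k - 1)"
    using sub * graded_by_invariant[OF gr *(4)]
    by (simp add: vec.subspace_diff vec.subspace_scale)
  finally have "inverse (of_int (k - l)) *s (of_int (k - l) *s e) \<in> W (k - 1)"
    by (rule vec.subspace_scale[OF sub])
  moreover have "of_int (k - l) \<noteq> (0 :: complex)"
    using \<open>k \<noteq> l\<close> by (simp del: of_int_diff)
  ultimately have "e \<in> W (k - 1)"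
    by (simp del: of_int_diff)
  then show ?thesis
    using * sub by (simp add: vec.subspace_add)
qed

lemma graded_by_eigsp_zero:
  assumes gr: "graded_by M W" and "v \<in> W k" "v \<in> eigsp M l" "k < l"
  shows "v = 0"
proof -
  have "\<forall>l>k. v \<in> eigsp M l \<longrightarrow> v = 0"
    using graded_by_filtration[OF gr] \<open>v \<in> W k\<close>
  proof (induction k v rule: increasing_filtration_induct)
    case (step k v)
    then show ?case
      using graded_by_eigsp_descend[OF gr step(2)] by (metis less_le_not_le less_trans zless_add1_eq diff_add_cancel)
  qed auto
  then show ?thesis
    using assms by blast
qed

lemma graded_by_eigsp_subset:
  assumes gr: "graded_by M W" and v: "v \<in> eigsp M l"
  shows "v \<in> W l"
proof -
  obtain K where K: "\<And>k v. K \<le> k \<Longrightarrow> v \<in> W k"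
    using increasing_filtration_all_above[OF graded_by_filtration[OF gr]] by blast
  \<comment> \<open>Starting where W is everything, v can be pushed down as long as the index
    differs from l; the second alternative records indices already past l.\<close>
  have "v \<in> W (max K l - int n) \<or> max K l - int n < l" for n
  proof (induction n)
    case (Suc n)
    then show ?case
      using graded_by_eigsp_descend[OF gr _ v, of "max K l - int n"]
      by (cases "max K l - int n = l") (auto simp: algebra_simps)
  qed (use K in auto)
  from this[of "nat (max K l - l)"] show ?thesis
    by auto
qed

section \<open>Complex \<open>sl\<^sub>2\<close>-triples\<close>

definition complex_sl2_triple ::
    "complex ^ 'n ^ 'n \<Rightarrow> complex ^ 'n ^ 'n \<Rightarrow> complex ^ 'n ^ 'n \<Rightarrow> bool" where
  "complex_sl2_triple Y M X \<longleftrightarrow>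
     (\<forall>v. X *v (Y *v v) = Y *v (X *v v) + M *v v) \<and>
     (\<forall>v. M *v (X *v v) = X *v (M *v v) + 2 *s (X *v v)) \<and>
     (\<forall>v. M *v (Y *v v) = Y *v (M *v v) - 2 *s (Y *v v))"

lemma matrix_vector_mult_uminus: "(- M) *v v = - (M *v (v :: complex ^ 'n))"
  by (simp add: vec_eq_iff matrix_vector_mult_def sum_negf)

text \<open>The symmetry between raising and lowering: results on powers of \<open>Y\<close>
  transfer to powers of \<open>X\<close>, with weights negated.\<close>

lemma complex_sl2_triple_swap:
  assumes "complex_sl2_triple Y M X"
  shows "complex_sl2_triple X (- M) Y"
  using assms by (simp add: complex_sl2_triple_def matrix_vector_mult_uminus vec.neg)

lemma eigsp_uminus: "eigsp (- M) l = eigsp M (- l)"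
  by (auto simp: eigsp_def matrix_vector_mult_uminus) (metis minus_minus vec.scale_minus_left)+

lemma mpow_Suc_apply: "mpow A (Suc k) *v v = A *v (mpow A k *v v)"
  by (simp add: matrix_vector_mul_assoc)

lemma mpow_add_apply: "mpow A (m + n) *v v = mpow A m *v (mpow A n *v v)"
  by (induction m) (simp_all add: mpow_Suc_apply matrix_vector_mul_assoc[symmetric] del: mpow.simps(2))

lemma raise_eigsp:
  assumes "complex_sl2_triple Y M X" "v \<in> eigsp M l"
  shows "X *v v \<in> eigsp M (l + 2)"
  using assms by (simp add: complex_sl2_triple_def eigsp_def vec.scale vec.scale_left_distrib)

lemma lower_eigsp:
  assumes "complex_sl2_triple Y M X" "v \<in> eigsp M l"
  shows "Y *v v \<in> eigsp M (l - 2)"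
  using assms by (simp add: complex_sl2_triple_def eigsp_def vec.scale vec.scale_left_diff_distrib)

lemma lower_pow_eigsp:
  assumes "complex_sl2_triple Y M X" "v \<in> eigsp M l"
  shows "mpow Y n *v v \<in> eigsp M (l - 2 * int n)"
proof (induction n)
  case (Suc n)
  show ?case
    using lower_eigsp[OF assms(1) Suc] by (simp add: mpow_Suc_apply algebra_simps del: mpow.simps(2))
qed (use assms in simp)

text \<open>Each commutation of X past a Y contributes the current weight; the coefficient is the
  sum l + (l - 2) + ... + (l - 2n).\<close>

lemma raise_lower_pow:
  assumes sl2: "complex_sl2_triple Y M X" and v: "v \<in> eigsp M l"
  shows "X *v (mpow Y (Suc n) *v v) =
    mpow Y (Suc n) *v (X *v v) + of_int ((int n + 1) * (l - int n)) *s (mpow Y n *v v)"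
proof (induction n)
  case 0
  show ?case
    using sl2 v by (simp add: complex_sl2_triple_def eigsp_def)
next
  case (Suc n)
  let ?u = "mpow Y (Suc n) *v v"
  have M: "M *v ?u = of_int (l - 2 * int (Suc n)) *s ?u"
    using lower_pow_eigsp[OF sl2 v, of "Suc n"] by (simp add: eigsp_def)
  have "X *v (mpow Y (Suc (Suc n)) *v v) = Y *v (X *v ?u) + M *v ?u"
    using sl2 by (simp add: complex_sl2_triple_def mpow_Suc_apply del: mpow.simps(2))
  also have "Y *v (X *v ?u) = mpow Y (Suc (Suc n)) *v (X *v v) +
      of_int ((int n + 1) * (l - int n)) *s ?u"
    unfolding Suc by (simp add: vec.add vec.scale mpow_Suc_apply del: mpow.simps(2))
  also have "\<dots> + M *v ?u = mpow Y (Suc (Suc n)) *v (X *v v) +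
      of_int ((int n + 1) * (l - int n) + (l - 2 * int (Suc n))) *s ?u"
    unfolding M by (simp only: of_int_add vec.scale_left_distrib add.assoc)
  also have "(int n + 1) * (l - int n) + (l - 2 * int (Suc n)) =
      (int (Suc n) + 1) * (l - int (Suc n))"
    by (simp add: algebra_simps)
  finally show ?case .
qed

text \<open>On a highest weight vector X undoes Y up to the factor (n + 1)(k - n), nonzero for n <
  k, so vanishing passes to the preceding power.\<close>

lemma highest_weight_lower_pow_inj:
  assumes sl2: "complex_sl2_triple Y M X" and v: "v \<in> eigsp M (int k)"
    and X: "X *v v = 0"
  shows "n \<le> k \<Longrightarrow> mpow Y n *v v = 0 \<Longrightarrow> v = 0"
proof (induction n)
  case (Suc n)
  have "of_int ((int n + 1) * (int k - int n)) *s (mpow Y n *v v) = 0"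
    using raise_lower_pow[OF sl2 v, of n] Suc.prems X by simp
  moreover have "(int n + 1) * (int k - int n) \<noteq> 0"
    using Suc.prems by auto
  ultimately have "mpow Y n *v v = 0"
    by (metis of_int_eq_0_iff vec.scale_eq_0_iff)
  then show ?case
    using Suc by simp
qed auto

text \<open>
  If \<open>Y\<^sup>k\<close> kills \<open>v\<close> of weight \<open>k\<close>, then \<open>Y\<^sup>k\<^sup>+\<^sup>2\<close> kills \<open>X v\<close> of weight \<open>k + 2\<close>; since \<open>X\<close> is
  nilpotent, this reduces the claim to highest weight vectors.
\<close>

lemma lower_pow_inj:
  assumes sl2: "complex_sl2_triple Y M X" and B: "\<And>l u. B < l \<Longrightarrow> u \<in> eigsp M l \<Longrightarrow> u = 0"
  shows "v \<in> eigsp M (int k) \<Longrightarrow> mpow Y k *v v = 0 \<Longrightarrow> v = 0"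
proof (induction "nat (B - int k + 1)" arbitrary: k v rule: less_induct)
  case less
  show ?case
  proof (cases "B < int k")
    case True
    then show ?thesis using B less by blast
  next
    case False
    have eq: "mpow Y (Suc k) *v v = 0" "mpow Y (Suc (Suc k)) *v v = 0"
      using less.prems by (simp_all add: mpow_Suc_apply del: mpow.simps(2))
    have "mpow Y (k + 2) *v (X *v v) = 0"
      using raise_lower_pow[OF sl2 less.prems(1), of "Suc k"] eq by (simp del: mpow.simps(2))
    moreover have "X *v v \<in> eigsp M (int (k + 2))"
      using raise_eigsp[OF sl2 less.prems(1)] by (simp add: add.commute)
    ultimately have "X *v v = 0"
      using less.hyps[of "k + 2" "X *v v"] False by simp
    then show ?thesis
      using highest_weight_lower_pow_inj[OF sl2 less.prems(1)] less.prems(2) by blast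
  qed
qed

text \<open>Finite dimension turns injectivity into surjectivity: Y^k X^k is an injective
  endomorphism of the weight space -k, because X^k is injective there by the swapped triple and Y^k
  is injective on weight k. The preimage found has the form X^k a.\<close>

lemma lower_pow_surj:
  assumes sl2: "complex_sl2_triple Y M X"
    and B: "\<And>l u. B < l \<Longrightarrow> u \<in> eigsp M l \<Longrightarrow> u = 0"
    and A: "\<And>l u. l < A \<Longrightarrow> u \<in> eigsp M l \<Longrightarrow> u = 0"
    and u: "u \<in> eigsp M (- int k)"
  obtains v where "v \<in> eigsp M (int k)" "mpow Y k *v v = u"
proof -
  let ?T = "\<lambda>v. mpow Y k *v (mpow X k *v v)" and ?E = "eigsp M (- int k)"
  note sl2' = complex_sl2_triple_swap[OF sl2]
  have up: "mpow X k *v v \<in> eigsp M (int k)" if "v \<in> ?E" for v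
    using lower_pow_eigsp[OF sl2', of v "int k" k] that by (simp add: eigsp_uminus)
  have into: "?T v \<in> ?E" if "v \<in> ?E" for v
    using lower_pow_eigsp[OF sl2 up[OF that], of k] by simp
  have ker: "v = 0" if "v \<in> ?E" "?T v = 0" for v
  proof -
    have "mpow X k *v v = 0"
      using lower_pow_inj[where B = B, OF sl2 _ up[OF that(1)] that(2)] B by blast
    moreover have "v \<in> eigsp (- M) (int k)"
      using that by (simp add: eigsp_uminus)
    \<comment> \<open>The weights of the swapped triple are the negatives, so the lower bound
      \<open>A\<close> becomes the upper bound \<open>- A\<close>.\<close>
    ultimately show ?thesis
      using lower_pow_inj[OF sl2', of "- A" v k] A by (simp add: eigsp_uminus minus_less_iff)
  qed
  have T: "?T = (*v) (mpow Y k ** mpow X k)"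
    by (simp add: fun_eq_iff matrix_vector_mul_assoc)
  have inj: "inj_on ?T ?E"
  proof (rule inj_onI)
    fix a b assume ab: "a \<in> ?E" "b \<in> ?E" "?T a = ?T b"
    then have "?T (a - b) = 0" by (simp add: vec.diff)
    with ab show "a = b"
      using ker[of "a - b"] vec.subspace_diff[OF eigsp_subspace, of a M "- int k" b] by simp
  qed
  have "vec.dim (?T ` ?E) = vec.dim ?E"
    using inj unfolding T
    by (intro vec.dim_image_eq)
      (simp_all add: vec.span_eq_iff[THEN iffD2, OF eigsp_subspace] matrix_vector_mul_linear_gen)
  moreover have "vec.subspace (?T ` ?E)"
    unfolding T by (intro vec.subspace_image eigsp_subspace matrix_vector_mul_linear_gen)
  ultimately have "?T ` ?E = ?E"
    using into by (intro vec.subspace_dim_equal) (auto simp: eigsp_subspace)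
  then have "u \<in> ?T ` ?E"
    using u by (simp only:)
  then obtain a where "a \<in> ?E" "?T a = u"
    by blast
  then show thesis
    using up that by blast
qed

section \<open>The monodromy weight filtration\<close>

text \<open>Modulo W_(k-1) every vector of W_k may be replaced by a weight vector; there Y lowers
  the weight by 2, and Y^k is a bijection from weight k to weight -k.\<close>

lemma mwf_of_sl2_triple:
  assumes sl2: "complex_sl2_triple Y M X" and gr: "graded_by M W"
  shows "is_monodromy_weight_filtration Y W"
proof -
  note inc = graded_by_filtration[OF gr]
  note sub = increasing_filtration_subspace[OF inc]
  have Y: "Y *v v \<in> W (k - 2)" if "v \<in> W k" for k v
    using inc that
  proof (induction k v rule: increasing_filtration_induct)
    case (zero k)
    show ?case using sub by (simp add: vec.subspace_0)
  next
    case (step k v)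
    obtain e u where *: "v = e + u" "e \<in> W k" "e \<in> eigsp M k" "u \<in> W (k - 1)"
      using graded_by_split[OF gr step(2)] .
    have "Y *v e \<in> W (k - 2)"
      using graded_by_eigsp_subset[OF gr lower_eigsp[OF sl2 *(3)]] .
    moreover have "Y *v u \<in> W (k - 2)"
      using step(1)[OF *(4)] increasing_filtration_mono[OF inc] by fastforce
    ultimately show ?case
      using * sub by (simp add: vec.add vec.subspace_add)
  qed
  have Yn: "mpow Y n *v v \<in> W (k - 2 * int n)" if "v \<in> W k" for k n v
  proof (induction n)
    case (Suc n)
    show ?case
      using Y[OF Suc] by (simp add: mpow_Suc_apply algebra_simps del: mpow.simps(2))
  qed (use that in simp)
  obtain K where K: "\<And>k v. K \<le> k \<Longrightarrow> v \<in> W k"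
    using increasing_filtration_all_above[OF inc] by blast
  obtain L where L: "\<And>k v. k \<le> L \<Longrightarrow> v \<in> W k \<Longrightarrow> v = 0"
    using increasing_filtration_zero_below[OF inc] by blast
  have above: "u = 0" if "K < l" "u \<in> eigsp M l" for l u
    using graded_by_eigsp_zero[OF gr, of u K l] K that by simp
  have below: "u = 0" if "l < L" "u \<in> eigsp M l" for l u
    using L[OF less_imp_le[OF that(1)] graded_by_eigsp_subset[OF gr that(2)]] .
  have inj: "v \<in> W (int k - 1)" if v: "v \<in> W (int k)" "mpow Y k *v v \<in> W (- int k - 1)" for k v
  proof -
    obtain e u where *: "v = e + u" "e \<in> W (int k)" "e \<in> eigsp M (int k)" "u \<in> W (int k - 1)"
      using graded_by_split[OF gr v(1)] .
    have "mpow Y k *v u \<in> W (- int k - 1)"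
      using Yn[OF *(4), of k] by simp
    then have "mpow Y k *v v - mpow Y k *v u \<in> W (- int k - 1)"
      using v(2) sub by (simp add: vec.subspace_diff)
    then have "mpow Y k *v e \<in> W (- int k - 1)"
      by (simp add: *(1) vec.add)
    moreover have "mpow Y k *v e \<in> eigsp M (- int k)"
      using lower_pow_eigsp[OF sl2 *(3), of k] by simp
    \<comment> \<open>The weights occurring in W_(-k-1) are at most -k-1, so a vector of weight -k
      in it vanishes.\<close>
    ultimately have "mpow Y k *v e = 0"
      using graded_by_eigsp_zero[OF gr] by fastforce
    then have "e = 0"
      using lower_pow_inj[where B = K, OF sl2 _ *(3)] above by blast
    then show ?thesis using * by simp
  qed
  have surj: "\<exists>v\<in>W (int k). u - mpow Y k *v v \<in> W (- int k - 1)" if u: "u \<in> W (- int k)" for k u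
  proof -
    obtain e t where *: "u = e + t" "e \<in> W (- int k)" "e \<in> eigsp M (- int k)" "t \<in> W (- int k - 1)"
      using graded_by_split[OF gr u] .
    obtain v where "v \<in> eigsp M (int k)" "mpow Y k *v v = e"
      using lower_pow_surj[where B = K and A = L, OF sl2 _ _ *(3)] above below by metis
    then show ?thesis
      using * graded_by_eigsp_subset[OF gr] by force
  qed
  show ?thesis
    unfolding is_monodromy_weight_filtration_def using inc Y inj surj by blast
qed

section \<open>Nilpotency, and uniqueness of the monodromy weight filtration\<close>

lemma mwf_mpow:
  assumes "is_monodromy_weight_filtration N W" "v \<in> W k"
  shows "mpow N n *v v \<in> W (k - 2 * int n)"
proof (induction n)
  case (Suc n)
  then have "N *v (mpow N n *v v) \<in> W (k - 2 * int n - 2)"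
    using assms(1) unfolding is_monodromy_weight_filtration_def by blast
  then show ?case
    by (simp add: mpow_Suc_apply algebra_simps del: mpow.simps(2))
qed (use assms in simp)

lemma mwf_nilpotent:
  assumes "is_monodromy_weight_filtration N W"
  shows "mnilpotent N"
proof -
  have inc: "increasing_filtration W"
    using assms by (simp add: is_monodromy_weight_filtration_def)
  obtain K where K: "\<And>k v. K \<le> k \<Longrightarrow> v \<in> W k"
    using increasing_filtration_all_above[OF inc] by blast
  obtain L where L: "\<And>k v. k \<le> L \<Longrightarrow> v \<in> W k \<Longrightarrow> v = 0"
    using increasing_filtration_zero_below[OF inc] by blast
  have "mpow N (nat (K - L)) *v v = 0" for v
  proof (cases "K \<le> L")
    case True
    then show ?thesis using K L by blast
  next
    case False
    then show ?thesis
      using mwf_mpow[OF assms K[of K v], of "nat (K - L)"] by (intro L) auto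
  qed
  then have "mpow N (nat (K - L)) = 0"
    by (simp add: matrix_eq)
  then show ?thesis
    by (auto simp: mnilpotent_def)
qed

text \<open>Applying N^(k-j) to the hypothesis reduces it to injectivity of N^k from Gr_k to
  Gr_(-k), which the definition provides.\<close>

lemma mwf_inj_pow:
  assumes mwf: "is_monodromy_weight_filtration N W"
    and x: "x \<in> W k" "mpow N j *v x \<in> W (k - 2 * int j - 1)" and "int j \<le> k"
  shows "x \<in> W (k - 1)"
proof -
  define m where "m = nat k"
  have k: "k = int m" "j \<le> m"
    using \<open>int j \<le> k\<close> by (auto simp: m_def)
  have "mpow N ((m - j) + j) *v x \<in> W (k - 2 * int j - 1 - 2 * int (m - j))"
    unfolding mpow_add_apply by (intro mwf_mpow[OF mwf] x(2))
  moreover have "k - 2 * int j - 1 - 2 * int (m - j) = - int m - 1" "(m - j) + j = m"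
    using k by (auto simp: of_nat_diff)
  ultimately have "mpow N m *v x \<in> W (- int m - 1)"
    by simp
  then show ?thesis
    using mwf x(1) k unfolding is_monodromy_weight_filtration_def by blast
qed

text \<open>
  The inclusion induces maps \<open>Gr\<^sup>W'\<^sub>k \<rightarrow> Gr\<^sup>W\<^sub>k\<^sub>+\<^sub>a\<close> commuting with \<open>N\<close>. A primitive class in degree
  \<open>k \<ge> 0\<close> is killed by \<open>N\<^sup>k\<^sup>+\<^sup>1\<close>, which is injective on \<open>Gr\<^sup>W\<^sub>k\<^sub>+\<^sub>a\<close> if \<open>a \<ge> 1\<close>.
\<close>

lemma mwf_subset_improve:
  assumes mwf: "is_monodromy_weight_filtration N W" and mwf': "is_monodromy_weight_filtration N W'"
    and "1 \<le> a" and le: "\<And>k. W' k \<subseteq> W (k + a)"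
  shows "W' k \<subseteq> W (k + a - 1)"
proof -
  have inc: "increasing_filtration W" and inc': "increasing_filtration W'"
    using mwf mwf' by (simp_all add: is_monodromy_weight_filtration_def)
  note sub = increasing_filtration_subspace[OF inc] and sub' = increasing_filtration_subspace[OF inc']
  have N: "N *v v \<in> W (k - 2)" if "v \<in> W k" for k v
    using mwf that unfolding is_monodromy_weight_filtration_def by blast
  have N': "N *v v \<in> W' (k - 2)" if "v \<in> W' k" for k v
    using mwf' that unfolding is_monodromy_weight_filtration_def by blast
  have surj': "\<exists>v\<in>W' (int k). u - mpow N k *v v \<in> W' (- int k - 1)" if "u \<in> W' (- int k)" for k u
    using mwf' that unfolding is_monodromy_weight_filtration_def by blast
  obtain K where K: "\<And>k v. K \<le> k \<Longrightarrow> v \<in> W k"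
    using increasing_filtration_all_above[OF inc] by blast
  have nonneg: "W' (int k) \<subseteq> W (int k + a - 1)" for k
  proof (induction "nat (K - int k)" arbitrary: k rule: less_induct)
    case less
    show ?case
    proof (cases "K \<le> int k")
      case True
      then show ?thesis using K[of "int k + a - 1"] \<open>1 \<le> a\<close> by auto
    next
      case False
      \<comment> \<open>Descending induction on k: the improved inclusion is known two degrees
        higher, where the correction u lives.\<close>
      have IH: "W' (int k + 2) \<subseteq> W (int k + a + 1)"
        using less[of "k + 2"] False by (simp add: algebra_simps)
      show ?thesis
      proof
        fix v assume v: "v \<in> W' (int k)"
        \<comment> \<open>Subtracting N u makes v primitive: N^(k+1) sends v - N u into W'_(-k-3),
          one step below where it sends a general element of W'_k.\<close>
        have "mpow N (Suc k) *v v \<in> W' (- int (k + 2))"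
          using mwf_mpow[OF mwf' v, of "Suc k"] by (simp add: algebra_simps del: mpow.simps(2))
        then obtain u where u: "u \<in> W' (int (k + 2))"
          "mpow N (Suc k) *v v - mpow N (k + 2) *v u \<in> W' (- int (k + 2) - 1)"
          using surj' by blast
        have "mpow N (k + 2) *v u = mpow N (Suc k) *v (N *v u)"
          using mpow_add_apply[of N "Suc k" 1 u] by (simp del: mpow.simps(2) add: mpow_Suc_apply)
        then have "mpow N (Suc k) *v (v - N *v u) \<in> W' (- int k - 3)"
          using u(2) by (simp add: vec.diff algebra_simps del: mpow.simps(2))
        then have t: "mpow N (Suc k) *v (v - N *v u) \<in> W (int k + a - 2 * int (Suc k) - 1)"
          using le[of "- int k - 3"] by (auto simp: algebra_simps simp del: mpow.simps(2))
        have Nu: "N *v u \<in> W' (int k)"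
          using N'[OF u(1)] by simp
        then have "v - N *v u \<in> W (int k + a)"
          using v sub' le by (blast intro: vec.subspace_diff)
        \<comment> \<open>Since a >= 1, k + 1 <= k + a, and N^(k+1) is injective on
          Gr_(k+a).\<close>
        then have "v - N *v u \<in> W (int k + a - 1)"
          using mwf_inj_pow[OF mwf _ t] \<open>1 \<le> a\<close> by simp
        moreover have "N *v u \<in> W (int k + a - 1)"
          using N[of u "int k + a + 1"] IH u(1) by (auto simp: algebra_simps)
        ultimately show "v \<in> W (int k + a - 1)"
          using sub vec.subspace_add by fastforce
      qed
    qed
  qed
  show ?thesis
  proof (cases "0 \<le> k")
    case True
    then show ?thesis using nonneg[of "nat k"] by simp
  next
    case False
    \<comment> \<open>In degree -m every class is N^m of a class in degree m, where the improvement
      is already known; the remainder in W'_(-m-1) gains its one degree from the index.\<close>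
    define m where "m = nat (- k)"
    have k: "k = - int m" using False by (simp add: m_def)
    show ?thesis
    proof
      fix u assume "u \<in> W' k"
      then obtain v where v: "v \<in> W' (int m)" "u - mpow N m *v v \<in> W' (- int m - 1)"
        using surj' k by blast
      have "mpow N m *v v \<in> W (k + a - 1)"
        using mwf_mpow[OF mwf, of v "int m + a - 1" m] nonneg v(1) k by (auto simp: algebra_simps)
      moreover have "u - mpow N m *v v \<in> W (k + a - 1)"
        using v(2) le[of "- int m - 1"] k by (auto simp: algebra_simps)
      ultimately show "u \<in> W (k + a - 1)"
        using sub vec.subspace_add by fastforce
    qed
  qed
qed

text \<open>Both filtrations are finite, so the inclusion is trivial after a large shift, which is
  then reduced to 0 one degree at a time. Exchanging the two filtrations gives equality.\<close>

lemma mwf_subset: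
  assumes mwf: "is_monodromy_weight_filtration N W" and mwf': "is_monodromy_weight_filtration N W'"
  shows "W' k \<subseteq> W k"
proof -
  have inc: "increasing_filtration W" and inc': "increasing_filtration W'"
    using mwf mwf' by (simp_all add: is_monodromy_weight_filtration_def)
  obtain K where K: "\<And>k v. K \<le> k \<Longrightarrow> v \<in> W k"
    using increasing_filtration_all_above[OF inc] by blast
  obtain L where L: "\<And>k v. k \<le> L \<Longrightarrow> v \<in> W' k \<Longrightarrow> v = 0"
    using increasing_filtration_zero_below[OF inc'] by blast
  have start: "W' k \<subseteq> W (k + int (nat (K - L)))" for k
  proof (cases "k \<le> L")
    case True
    then show ?thesis
      using L increasing_filtration_subspace[OF inc] by (force simp: vec.subspace_0)
  qed (use K in auto)
  have "(\<forall>k. W' k \<subseteq> W (k + int a)) \<Longrightarrow> W' k \<subseteq> W k" for a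
  proof (induction a)
    case (Suc a)
    then show ?case
      using mwf_subset_improve[OF mwf mwf', of "int (Suc a)"] by simp
  qed (metis add.right_neutral of_nat_0)
  then show ?thesis
    using start by blast
qed

lemma monodromy_weight_filtration_eqI:
  assumes "is_monodromy_weight_filtration N W"
  shows "monodromy_weight_filtration N = W"
  unfolding monodromy_weight_filtration_def
proof (rule the_equality)
  fix W' assume "is_monodromy_weight_filtration N W'"
  then show "W' = W"
    using mwf_subset[of N] assms by blast
qed (fact assms)

section \<open>Deligne's bigrading\<close>

lemma cvec_add: "cvec (u + v) = cvec u + cvec v"
  by (simp add: cvec_def vec_eq_iff)

lemma cvec_scale: "cvec (c *s v) = cnj c *s cvec v"
  by (simp add: cvec_def vec_eq_iff)

lemma subspace_cvec_image:
  assumes "vec.subspace S"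
  shows "vec.subspace (cvec ` S)"
  unfolding vec.subspace_def
proof (intro conjI allI ballI)
  show "0 \<in> cvec ` S"
    by (rule image_eqI[of _ _ 0]) (use assms in \<open>auto simp: cvec_def vec_eq_iff vec.subspace_0\<close>)
next
  fix x y assume "x \<in> cvec ` S" "y \<in> cvec ` S"
  then show "x + y \<in> cvec ` S"
    using assms by (auto simp: cvec_add[symmetric] vec.subspace_add)
next
  fix c x assume "x \<in> cvec ` S"
  then obtain u where "u \<in> S" "x = cvec u" by blast
  then have "c *s x = cvec (cnj c *s u)" "cnj c *s u \<in> S"
    using assms by (auto simp: cvec_scale vec.subspace_scale)
  then show "c *s x \<in> cvec ` S" by blast
qed

lemma subspace_set_plus:
  assumes "vec.subspace A" "vec.subspace B"
  shows "vec.subspace (A + B :: (complex ^ 'n) set)"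
proof -
  have "A + B = {x + y |x y. x \<in> A \<and> y \<in> B}"
    by (auto simp: set_plus_def)
  then show ?thesis
    using vec.subspace_sums[OF assms] by (rule ssubst)
qed

lemma mhs_decompose:
  assumes "mixed_hodge_structure F W" "v \<in> W k"
  obtains a b c where "v = a + b + c" "a \<in> F p" "a \<in> W k" "b \<in> cvec ` F (k - p + 1)" "b \<in> W k"
    "c \<in> W (k - 1)"
proof -
  have "v \<in> (F p \<inter> W k) + (cvec ` F (k - p + 1) \<inter> W k) + W (k - 1)"
    using assms by (simp add: mixed_hodge_structure_def)
  then show thesis
    using that by (auto elim!: set_plus_elim)
qed

text \<open>
  Each class of type \<open>(p, q)\<close> in \<open>Gr\<^sup>W\<^sub>p\<^sub>+\<^sub>q\<close> is represented in \<open>I\<^sup>p\<^sup>,\<^sup>q\<close>: the error in \<open>W\<^sub>k\<^sub>-\<^sub>l\<close> is split by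
  the pure Hodge structure on \<open>Gr\<^sup>W\<^sub>k\<^sub>-\<^sub>l\<close>; its \<open>F\<^sup>p\<close>-part corrects the representative and its
  conjugate part is absorbed by the span in the definition of \<open>I\<^sup>p\<^sup>,\<^sup>q\<close>.
\<close>

lemma deligne_lift:
  assumes mhs: "mixed_hodge_structure F W"
    and v: "v \<in> F p" "v \<in> W (p + q)"
    and v': "v = b0 + c0" "b0 \<in> cvec ` F q" "b0 \<in> W (p + q)" "c0 \<in> W (p + q - 1)"
  obtains v' where "v' \<in> deligne F W p q" "v - v' \<in> W (p + q - 1)"
proof -
  let ?k = "p + q"
  define S where "S = vec.span (\<Union>j::nat. cvec ` F (q - 1 - int j) \<inter> W (p + q - 2 - int j))"
  define U where "U = (cvec ` F q \<inter> W ?k) + S"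
  have dec: "decreasing_filtration F" and inc: "increasing_filtration W"
    using mhs by (auto simp: mixed_hodge_structure_def)
  have subF: "vec.subspace (F p)" for p
    using dec by (simp add: decreasing_filtration_def)
  note subW = increasing_filtration_subspace[OF inc]
  have subA: "vec.subspace (cvec ` F q \<inter> W ?k)"
    by (intro vec.subspace_inter subspace_cvec_image subF subW)
  then have subU: "vec.subspace U"
    unfolding U_def S_def by (intro subspace_set_plus vec.subspace_span)
  have AU: "b \<in> U" if "b \<in> cvec ` F q" "b \<in> W ?k" for b
    unfolding U_def using set_plus_intro[of b "cvec ` F q \<inter> W ?k" 0 S] that
    by (simp add: S_def vec.span_zero)
  have SU: "b \<in> U" if "b \<in> cvec ` F (q - 1 - int j)" "b \<in> W (?k - 2 - int j)" for b j
  proof -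
    have "b \<in> S"
      unfolding S_def using that by (intro vec.span_base) auto
    then show ?thesis
      unfolding U_def using set_plus_intro[of 0 "cvec ` F q \<inter> W ?k" b S] vec.subspace_0[OF subA]
      by simp
  qed
  \<comment> \<open>Successive approximation: x stays in F^p and W_k and congruent to v, while its
    failure to lie in U is pushed down to W_(k-1-l).\<close>
  have approx: "\<exists>x u c. x = u + c \<and> x \<in> F p \<and> x \<in> W ?k \<and> v - x \<in> W (?k - 1) \<and> u \<in> U \<and>
      c \<in> W (?k - 1 - int l)" for l
  proof (induction l)
    case 0
    show ?case
      using v v' AU vec.subspace_0[OF subW] by (intro exI[of _ v] exI[of _ b0] exI[of _ c0]) auto
  next
    case (Suc l)
    then obtain x u c where x: "x = u + c" "x \<in> F p" "x \<in> W ?k" "v - x \<in> W (?k - 1)" "u \<in> U"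
      "c \<in> W (?k - 1 - int l)" by blast
    obtain a b d where c: "c = a + b + d" "a \<in> F p" "a \<in> W (?k - 1 - int l)"
      "b \<in> cvec ` F (?k - 1 - int l - p + 1)" "b \<in> W (?k - 1 - int l)" "d \<in> W (?k - 1 - int l - 1)"
      using mhs_decompose[OF mhs x(6)] .
    have a: "a \<in> W (?k - 1)" "a \<in> W ?k"
      using increasing_filtration_mono[OF inc c(3)] by auto
    \<comment> \<open>The conjugate index is q - l. For l = 0 the term b fits into the first summand
      of U; for l = j + 1 it lies in the j-th member of the union spanning S.\<close>
    have "b \<in> U"
    proof (cases l)
      case 0
      then show ?thesis
        using c(4,5) increasing_filtration_mono[OF inc c(5), of ?k] by (intro AU) auto
    next
      case (Suc j)
      then show ?thesis
        using c(4,5) by (intro SU[of b j]) (auto simp: algebra_simps)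
    qed
    then have "u + b \<in> U"
      using x subU by (simp add: vec.subspace_add)
    moreover have "v - x + a \<in> W (?k - 1)"
      using a x subW by (simp add: vec.subspace_add)
    then have "v - (x - a) \<in> W (?k - 1)"
      by (simp add: algebra_simps)
    moreover have "x - a = (u + b) + d"
      using x(1) c(1) by simp
    moreover have "x - a \<in> F p" "x - a \<in> W ?k"
      using x(2,3) c(2) a(2) subF subW by (simp_all only: vec.subspace_diff)
    moreover have "d \<in> W (?k - 1 - int (Suc l))"
      using c(6) by (simp add: algebra_simps)
    ultimately show ?case
      by blast
  qed
  obtain L where L: "\<And>k v. k \<le> L \<Longrightarrow> v \<in> W k \<Longrightarrow> v = 0"
    using increasing_filtration_zero_below[OF inc] by blast
  obtain x u c where x: "x = u + c" "x \<in> F p" "x \<in> W ?k" "v - x \<in> W (?k - 1)" "u \<in> U"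
    "c \<in> W (?k - 1 - int (nat (?k - 1 - L)))"
    using approx by blast
  have "c = 0"
    using x(6) by (rule L[rotated]) auto
  then have "x \<in> deligne F W p q"
    using x by (simp add: deligne_def U_def S_def)
  then show thesis
    using that x by blast
qed

text \<open>An arbitrary T avoids forming the sum of the Deligne components. The vector is peeled
  along the Hodge filtration: modulo W_(k-1), a class in F^p splits into a part in F^(p+1) and a
  part of type (p, k-p), and the latter lifts to a Deligne component. The process ends where F is
  zero.\<close>

lemma mhs_weight_decompose:
  assumes mhs: "mixed_hodge_structure F W" and T: "vec.subspace T"
    and D: "\<And>p q. p + q = k \<Longrightarrow> deligne F W p q \<subseteq> T" and v: "v \<in> W k"
  obtains e where "e \<in> T" "e \<in> W k" "v - e \<in> W (k - 1)"
proof -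
  have dec: "decreasing_filtration F" and inc: "increasing_filtration W"
    using mhs by (auto simp: mixed_hodge_structure_def)
  have subF: "vec.subspace (F p)" for p
    using dec by (simp add: decreasing_filtration_def)
  note subW = increasing_filtration_subspace[OF inc]
  have antiF: "F m \<subseteq> F l" if "l \<le> m" for l m
    using dec that by (auto simp: decreasing_filtration_def antimono_def)
  obtain P where P: "F P = UNIV"
    using dec by (auto simp: decreasing_filtration_def)
  obtain P' where P': "F P' = {0}"
    using dec by (auto simp: decreasing_filtration_def)
  have "\<exists>x e. v = x + e \<and> x \<in> F (P + int l) + W (k - 1) \<and> e \<in> T \<and> e \<in> W k" for l
  proof (induction l)
    case 0
    have "v + 0 \<in> F P + W (k - 1)"
      using P subW by (intro set_plus_intro) (auto simp: vec.subspace_0)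
    then show ?case
      using T subW by (intro exI[of _ v] exI[of _ 0]) (auto simp: vec.subspace_0)
  next
    case (Suc l)
    let ?p = "P + int l"
    obtain x c e where x: "v = (x + c) + e" "x \<in> F ?p" "c \<in> W (k - 1)" "e \<in> T" "e \<in> W k"
      using Suc by (auto elim!: set_plus_elim)
    have cW: "c \<in> W k"
      using increasing_filtration_mono[OF inc x(3)] by simp
    have "v - c - e \<in> W k"
      using cW v x subW by (intro vec.subspace_diff) auto
    then have "x \<in> W k"
      using x(1) by (simp add: algebra_simps)
    then obtain a b d where d: "x = a + b + d" "a \<in> F (?p + 1)" "a \<in> W k"
      "b \<in> cvec ` F (k - (?p + 1) + 1)" "b \<in> W k" "d \<in> W (k - 1)"
      using mhs_decompose[OF mhs, where p = "?p + 1"] by metis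
    have "x - a \<in> F ?p"
      using x d antiF[of ?p "?p + 1"] subF by (intro vec.subspace_diff) auto
    moreover have "x - a \<in> W k"
      using \<open>x \<in> W k\<close> d subW by (intro vec.subspace_diff) auto
    moreover have "x - a = b + d"
      using d by simp
    ultimately obtain i where i: "i \<in> deligne F W ?p (k - ?p)" "x - a - i \<in> W (k - 1)"
      using deligne_lift[OF mhs, of "x - a" ?p "k - ?p" b d] d by (auto simp: algebra_simps)
    have iW: "i \<in> W k"
      using i(1) by (simp add: deligne_def)
    have "a + ((x - a - i) + c) \<in> F (?p + 1) + W (k - 1)"
      using d i x subW by (intro set_plus_intro vec.subspace_add) auto
    moreover have "e + i \<in> T" "e + i \<in> W k"
      using x i iW D[of ?p "k - ?p"] T subW by (auto intro: vec.subspace_add)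
    ultimately show ?case
      using x(1) by (intro exI[of _ "a + ((x - a - i) + c)"] exI[of _ "e + i"])
        (auto simp: algebra_simps)
  qed
  from this[of "nat (P' - P)"] obtain x c e where x: "v = (x + c) + e"
    "x \<in> F (P + int (nat (P' - P)))" "c \<in> W (k - 1)" "e \<in> T" "e \<in> W k"
    by (auto elim!: set_plus_elim)
  have "P' \<le> P + int (nat (P' - P))"
    by simp
  then have "x \<in> F P'"
    using x(2) antiF by blast
  then have "x = 0"
    by (simp add: P')
  then show thesis
    using that x by simp
qed

text \<open>I^{p,q} sits in W_(p+q) but has eigenvalue p + q - w; shifting the index by w makes the
  two agree.\<close>

lemma graded_by_weight_grading:
  assumes mhs: "mixed_hodge_structure F W" and wg: "weight_grading w F W H"
  shows "graded_by (cmat H) (\<lambda>k. W (k + w))"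
proof -
  have inc: "increasing_filtration W"
    using mhs by (simp add: mixed_hodge_structure_def)
  obtain K L where KL: "W K = UNIV" "W L = {0}"
    using inc by (auto simp: increasing_filtration_def)
  have "\<exists>k. W (k + w) = UNIV" "\<exists>k. W (k + w) = {0}"
    using KL by (auto intro: exI[of _ "K - w"] exI[of _ "L - w"])
  then have "increasing_filtration (\<lambda>k. W (k + w))"
    using inc by (auto simp: increasing_filtration_def mono_def)
  moreover have "\<exists>e\<in>W (k + w) \<inter> eigsp (cmat H) k. v - e \<in> W (k - 1 + w)"
    if v: "v \<in> W (k + w)" for k v
  proof -
    have "deligne F W p q \<subseteq> eigsp (cmat H) k" if "p + q = k + w" for p q
    proof -
      have "p + q - w = k" using that by simp
      then show ?thesis
        using wg unfolding weight_grading_def eigsp_def by blast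
    qed
    then obtain e where "e \<in> eigsp (cmat H) k" "e \<in> W (k + w)" "v - e \<in> W (k + w - 1)"
      using mhs_weight_decompose[OF mhs eigsp_subspace _ v] by metis
    then show ?thesis by (auto simp: algebra_simps)
  qed
  ultimately show ?thesis
    by (simp add: graded_by_def)
qed

section \<open>Real \<open>sl\<^sub>2\<close>-triples\<close>

lemma cmat_mult: "cmat (A ** B) = cmat A ** cmat B"
  by (simp add: cmat_def vec_eq_iff matrix_matrix_mult_def)

lemma cmat_add: "cmat (A + B) = cmat A + cmat B"
  by (simp add: cmat_def vec_eq_iff)

lemma cmat_scaleR_apply: "cmat (c *\<^sub>R A) *v v = complex_of_real c *s (cmat A *v v)"
  by (simp add: cmat_def vec_eq_iff matrix_vector_mult_def sum_distrib_left mult.assoc)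

lemma cmat_mat: "cmat (mat 1) = mat 1"
  by (simp add: cmat_def vec_eq_iff mat_def)

lemma cmat_mpow: "cmat (mpow A k) = mpow (cmat A) k"
  by (induction k) (simp_all add: cmat_mult cmat_mat)

lemma mnilpotent_cmat: "mnilpotent (cmat A) \<Longrightarrow> mnilpotent A"
  by (simp add: mnilpotent_def cmat_mpow[symmetric]) (simp add: cmat_def vec_eq_iff)

lemma complex_sl2_triple_cmat:
  assumes "sl2_triple Y H X"
  shows "complex_sl2_triple (cmat Y) (cmat H) (cmat X)"
proof -
  have eq: "X ** Y = Y ** X + H" "H ** X = X ** H + 2 *\<^sub>R X" "H ** Y = Y ** H + (- 2) *\<^sub>R Y"
    using assms unfolding sl2_triple_def lie_def by (metis add.commute diff_add_cancel)+
  show ?thesis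
    unfolding complex_sl2_triple_def matrix_vector_mul_assoc cmat_mult[symmetric] eq
    by (simp add: cmat_add matrix_vector_mult_add_rdistrib cmat_scaleR_apply del: scaleR_minus_left)
qed

section \<open>Bilinearity of the bracket, and sums of commuting triples\<close>

lemma matrix_add_rdistrib: "(A + B) ** C = A ** C + B ** (C :: 'a :: semiring_1 ^ 'n ^ 'm)"
  by (simp add: vec_eq_iff matrix_matrix_mult_def distrib_right sum.distrib)

lemma matrix_diff_ldistrib: "C ** (A - B) = C ** A - C ** (B :: 'a :: ring_1 ^ 'n ^ 'm)"
  by (simp add: vec_eq_iff matrix_matrix_mult_def right_diff_distrib sum_subtractf)

lemma matrix_diff_rdistrib: "(A - B) ** C = A ** C - B ** (C :: 'a :: ring_1 ^ 'n ^ 'm)"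
  by (simp add: vec_eq_iff matrix_matrix_mult_def left_diff_distrib sum_subtractf)

lemma lie_add: "lie (A + B) C = lie A C + lie B C" "lie C (A + B) = lie C A + lie C B"
  for A B C :: "real ^ 'n ^ 'n"
  by (simp_all add: lie_def matrix_add_ldistrib matrix_add_rdistrib)

lemma lie_scaleR: "lie (c *\<^sub>R A) B = c *\<^sub>R lie A B" "lie A (c *\<^sub>R B) = c *\<^sub>R lie A B"
  for A B :: "real ^ 'n ^ 'n"
  by (simp_all add: lie_def scaleR_diff_right scalar_matrix_assoc matrix_scalar_ac)

lemma lie_zero: "lie 0 A = 0" "lie A 0 = 0" for A :: "real ^ 'n ^ 'n"
  by (simp_all add: lie_def)

lemma lie_sum: "lie (\<Sum>i\<in>I. f i) (\<Sum>j\<in>J. g j) = (\<Sum>i\<in>I. \<Sum>j\<in>J. lie (f i) (g j))"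
  for f g :: "'a \<Rightarrow> real ^ 'n ^ 'n"
proof -
  have "lie A (\<Sum>j\<in>J. g j) = (\<Sum>j\<in>J. lie A (g j))" for A :: "real ^ 'n ^ 'n"
    by (induction J rule: infinite_finite_induct) (simp_all add: lie_zero lie_add)
  then show ?thesis
    by (induction I rule: infinite_finite_induct) (simp_all add: lie_zero lie_add sum.distrib)
qed

lemma lie_sum_diagonal:
  fixes f g :: "'a \<Rightarrow> real ^ 'n ^ 'n"
  assumes "finite I" "\<And>i j. i \<in> I \<Longrightarrow> j \<in> I \<Longrightarrow> i \<noteq> j \<Longrightarrow> lie (f i) (g j) = 0"
  shows "lie (\<Sum>i\<in>I. f i) (\<Sum>j\<in>I. g j) = (\<Sum>i\<in>I. lie (f i) (g i))"
proof -
  have "(\<Sum>j\<in>I. lie (f i) (g j)) = lie (f i) (g i)" if "i \<in> I" for i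
    using assms that by (subst sum.remove[of _ i]) (auto intro!: sum.neutral)
  then show ?thesis
    by (simp add: lie_sum)
qed

text \<open>Distinct indices contribute nothing, and y_j cancels 1/y_j in [X_j, Y_j] = H_j; this is
  why the raising elements are divided by y_j.\<close>

lemma sl2_triple_sum:
  fixes X H Y :: "nat \<Rightarrow> real ^ 'n ^ 'n"
  assumes "finite I" and y: "\<And>j. j \<in> I \<Longrightarrow> y j \<noteq> 0"
    and triple: "\<And>j. j \<in> I \<Longrightarrow> sl2_triple (Y j) (H j) (X j)"
    and comm: "\<And>j k A B. j \<in> I \<Longrightarrow> k \<in> I \<Longrightarrow> j \<noteq> k \<Longrightarrow> A \<in> {Y j, H j, X j} \<Longrightarrow>
      B \<in> {Y k, H k, X k} \<Longrightarrow> lie A B = 0"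
  shows "sl2_triple (\<Sum>j\<in>I. y j *\<^sub>R Y j) (\<Sum>j\<in>I. H j) (\<Sum>j\<in>I. (1 / y j) *\<^sub>R X j)"
  using assms
  by (simp add: sl2_triple_def lie_sum_diagonal lie_scaleR scaleR_sum_right scaleR_left_commute
      sum_negf mult.commute)

section \<open>Conjugation by invertible matrices\<close>

lemma matrix_inv_cancel:
  assumes "invertible (g :: real ^ 'n ^ 'n)"
  shows "matrix_inv g ** g = mat 1" "g ** matrix_inv g = mat 1"
  using someI_ex[OF assms[unfolded invertible_def]] by (simp_all add: matrix_inv_def)

lemma Ad_mult:
  assumes "invertible g"
  shows "Ad g A ** Ad g B = Ad g (A ** B)"
proof -
  have "Ad g A ** Ad g B = g ** A ** (matrix_inv g ** g) ** B ** matrix_inv g"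
    by (simp add: Ad_def matrix_mul_assoc)
  then show ?thesis
    by (simp add: Ad_def matrix_inv_cancel[OF assms] matrix_mul_assoc)
qed

lemma Ad_diff: "Ad g (A - B) = Ad g A - Ad g B"
  by (simp add: Ad_def matrix_diff_ldistrib matrix_diff_rdistrib)

lemma Ad_scaleR: "Ad g (c *\<^sub>R A) = c *\<^sub>R Ad g A"
  by (simp add: Ad_def scalar_matrix_assoc matrix_scalar_ac)

lemma lie_Ad: "invertible g \<Longrightarrow> lie (Ad g A) (Ad g B) = Ad g (lie A B)"
  by (simp add: lie_def Ad_mult Ad_diff)

lemma Ad_fixed:
  assumes "invertible g" "g ** A = A ** g"
  shows "Ad g A = A"
proof -
  have "Ad g A = A ** (g ** matrix_inv g)"
    using assms by (simp add: Ad_def matrix_mul_assoc)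
  then show ?thesis
    using assms by (simp add: matrix_inv_cancel)
qed

lemma sl2_triple_Ad:
  assumes "invertible g" "sl2_triple Y H X"
  shows "sl2_triple (Ad g Y) (Ad g H) (Ad g X)"
  using assms by (simp add: sl2_triple_def lie_Ad Ad_scaleR del: scaleR_minus_left)

section \<open>The Lie algebra and the group of the form\<close>

lemma g_real_0: "0 \<in> g_real Q"
  by (simp add: g_real_def transpose_def vec_eq_iff matrix_matrix_mult_def)

lemma g_real_add:
  assumes "A \<in> g_real Q" "B \<in> g_real Q"
  shows "A + B \<in> g_real Q"
proof -
  have "transpose (A + B) = transpose A + transpose B"
    by (simp add: transpose_def vec_eq_iff)
  then have "transpose (A + B) ** Q + Q ** (A + B) =
      (transpose A ** Q + Q ** A) + (transpose B ** Q + Q ** B)"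
    by (simp add: matrix_add_ldistrib matrix_add_rdistrib)
  then show ?thesis
    using assms by (simp add: g_real_def)
qed

lemma g_real_scaleR:
  assumes "A \<in> g_real Q"
  shows "c *\<^sub>R A \<in> g_real Q"
proof -
  have "transpose (c *\<^sub>R A) = c *\<^sub>R transpose A"
    by (simp add: transpose_def vec_eq_iff)
  then have "transpose (c *\<^sub>R A) ** Q + Q ** (c *\<^sub>R A) = c *\<^sub>R (transpose A ** Q + Q ** A)"
    by (simp add: scaleR_add_right scalar_matrix_assoc matrix_scalar_ac)
  then show ?thesis
    using assms by (simp add: g_real_def)
qed

lemma g_real_sum: "(\<And>i. i \<in> I \<Longrightarrow> f i \<in> g_real Q) \<Longrightarrow> (\<Sum>i\<in>I. f i) \<in> g_real Q"
  by (induction I rule: infinite_finite_induct) (auto simp: g_real_0 g_real_add)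

lemma g_real_Ad:
  assumes g: "g \<in> G_real Q" and A: "A \<in> g_real Q"
  shows "Ad g A \<in> g_real Q"
proof -
  let ?i = "matrix_inv g"
  have inv: "invertible g" and gQ: "transpose g ** Q ** g = Q"
    using g by (auto simp: G_real_def)
  have tinv: "transpose ?i ** transpose g = mat 1"
    by (simp add: matrix_transpose_mul[symmetric] matrix_inv_cancel[OF inv] transpose_mat)
  \<comment> \<open>Invariance of Q moves g across Q. Both terms then share the inverse transpose of
    g on the left and the inverse of g on the right, with the condition on A in between.\<close>
  have Qi: "transpose g ** Q = Q ** ?i"
    by (metis gQ inv matrix_inv_cancel(2) matrix_mul_assoc matrix_mul_rid)
  have Qg: "Q ** g = transpose ?i ** Q"
    by (metis gQ tinv matrix_mul_assoc matrix_mul_lid)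
  have "transpose (Ad g A) ** Q + Q ** Ad g A =
      transpose ?i ** transpose A ** (transpose g ** Q) + (Q ** g) ** A ** ?i"
    by (simp add: Ad_def matrix_transpose_mul matrix_mul_assoc)
  also have "\<dots> = transpose ?i ** (transpose A ** Q + Q ** A) ** ?i"
    unfolding Qi Qg by (simp add: matrix_add_ldistrib matrix_add_rdistrib matrix_mul_assoc)
  also have "\<dots> = 0"
    using A by (simp add: g_real_def)
  finally show ?thesis
    by (simp add: g_real_def)
qed

lemma G_real_mult:
  assumes "a \<in> G_real Q" "b \<in> G_real Q"
  shows "a ** b \<in> G_real Q"
proof -
  have "transpose (a ** b) ** Q ** (a ** b) = transpose b ** (transpose a ** Q ** a) ** b"
    by (simp add: matrix_transpose_mul matrix_mul_assoc)
  then show ?thesis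
    using assms by (simp add: G_real_def invertible_mult)
qed

lemma g_prod_in_G_real:
  assumes "\<And>j. j \<in> {1..m} \<Longrightarrow> g j (\<lambda>k\<in>{1..j}. y k / y (j + 1)) \<in> G_real Q"
  shows "g_prod g y m \<in> G_real Q"
  using assms
proof (induction m)
  case 0
  show ?case
    by (simp add: G_real_def transpose_mat) (auto simp: invertible_def)
next
  case (Suc m)
  have "g_prod g y m \<in> G_real Q"
    by (intro Suc) auto
  moreover have "g (Suc m) (\<lambda>k\<in>{1..Suc m}. y k / y (Suc m + 1)) \<in> G_real Q"
    by (intro Suc.prems) auto
  ultimately show ?case
    unfolding g_prod.simps by (intro G_real_mult)
qed

text \<open>Positivity propagates downwards from y_(r+1) = 1, as each ratio exceeds c >= 0.\<close>

lemma ratios_exceed_pos: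
  assumes "ratios_exceed r c y" "0 \<le> c" "j \<in> {1..r}"
  shows "0 < y j"
proof -
  have "0 < y (r + 1 - k)" if "k \<le> r" for k
    using that
  proof (induction k)
    case 0
    then show ?case using assms(1) by (simp add: ratios_exceed_def)
  next
    case (Suc k)
    let ?j = "r + 1 - Suc k"
    have "?j \<in> {1..r}" "?j + 1 = r + 1 - k"
      using Suc.prems by auto
    moreover from this have "0 < y ?j / y (?j + 1)"
      using assms(1,2) unfolding ratios_exceed_def by fastforce
    ultimately show ?case
      using Suc by (simp add: zero_less_divide_iff)
  qed
  from this[of "r + 1 - j"] show ?thesis
    using assms(3) by auto
qed

section \<open>Nilpotent orbits\<close>

lemma cmat_sum: "cmat (\<Sum>i\<in>I. f i) = (\<Sum>i\<in>I. cmat (f i))"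
  by (simp add: cmat_def vec_eq_iff)

lemma cmat_scaleR: "cmat (c *\<^sub>R A) = mscale (complex_of_real c) (cmat A)"
  by (simp add: cmat_def mscale_def vec_eq_iff)

lemma mscale_sum: "mscale c (\<Sum>i\<in>I. f i) = (\<Sum>i\<in>I. mscale c (f i))"
  by (simp add: mscale_def vec_eq_iff sum_distrib_left)

lemma mscale_mscale: "mscale a (mscale b A) = mscale (a * b) A"
  by (simp add: mscale_def vec_eq_iff mult.assoc)

lemma sum_matrix_vector: "(\<Sum>i\<in>I. f i) *v v = (\<Sum>i\<in>I. f i *v (v :: complex ^ 'n))"
  by (induction I rule: infinite_finite_induct) (simp_all add: matrix_vector_mult_add_rdistrib)

text \<open>The one-variable orbit is the given one restricted to z_j = z y_j. Nilpotency is assumed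
  here because it will come from the weight filtration.\<close>

lemma nilpotent_orbit_cone:
  assumes orb: "nilpotent_orbit w Q h r N F" and y: "\<And>j. j \<in> {1..r} \<Longrightarrow> 0 < y j"
    and nil: "mnilpotent (\<Sum>j=1..r. y j *\<^sub>R N j)"
  shows "nilpotent_orbit w Q h 1 (\<lambda>_. \<Sum>j=1..r. y j *\<^sub>R N j) F"
proof -
  let ?N = "\<Sum>j=1..r. y j *\<^sub>R N j"
  have r: "1 \<le> r" and N: "\<And>j. j \<in> {1..r} \<Longrightarrow> N j \<in> g_real Q" and F: "F \<in> compact_dual w Q h"
    using orb by (auto simp: nilpotent_orbit_def)
  have hor: "cmat (N j) *v v \<in> F (p - 1)" if "j \<in> {1..r}" "v \<in> F p" for j p v
    using orb that unfolding nilpotent_orbit_def by blast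
  obtain c where c: "\<And>z. (\<forall>j\<in>{1..r}. c < Im (z j)) \<Longrightarrow>
      act (mexp (\<Sum>j=1..r. mscale (z j) (cmat (N j)))) F \<in> classifying_space w Q h"
    using orb unfolding nilpotent_orbit_def by blast
  have subF: "vec.subspace (F p)" for p
    using F by (simp add: compact_dual_def decreasing_filtration_def)
  have hor': "cmat ?N *v v \<in> F (p - 1)" if "v \<in> F p" for p v
    unfolding cmat_sum sum_matrix_vector cmat_scaleR_apply
    by (intro vec.subspace_sum subF vec.subspace_scale hor that)
  define m where "m = Min (y ` {1..r})"
  have m: "0 < m" "\<And>j. j \<in> {1..r} \<Longrightarrow> m \<le> y j"
    using r y by (auto simp: m_def)
  \<comment> \<open>For Im z > |c|/m one has y_j Im z >= m Im z > |c| >= c. The absolute value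
    covers negative c and keeps Im z nonnegative, so that the minimum m may be replaced by
    y_j.\<close>
  have orb': "act (mexp (mscale z (cmat ?N))) F \<in> classifying_space w Q h" if "\<bar>c\<bar> / m < Im z" for z
  proof -
    have "c < Im (z * complex_of_real (y j))" if "j \<in> {1..r}" for j
    proof -
      have "\<bar>c\<bar> < m * Im z"
        using \<open>\<bar>c\<bar> / m < Im z\<close> m(1) by (simp add: divide_less_eq mult.commute)
      moreover have "0 \<le> \<bar>c\<bar> / m"
        using m(1) by simp
      then have "m * Im z \<le> y j * Im z"
        using m(2)[OF that] \<open>\<bar>c\<bar> / m < Im z\<close> by (intro mult_right_mono) auto
      ultimately have "c < y j * Im z"
        by linarith
      then show ?thesis by (simp add: mult.commute)
    qed
    then have "act (mexp (\<Sum>j=1..r. mscale (z * complex_of_real (y j)) (cmat (N j)))) F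
        \<in> classifying_space w Q h"
      by (intro c) blast
    moreover have "mscale z (cmat ?N) = (\<Sum>j=1..r. mscale (z * complex_of_real (y j)) (cmat (N j)))"
      by (simp add: cmat_sum cmat_scaleR mscale_sum mscale_mscale)
    ultimately show ?thesis by simp
  qed
  have g: "?N \<in> g_real Q"
    by (intro g_real_sum g_real_scaleR N)
  show ?thesis
    unfolding nilpotent_orbit_def using F g nil hor' orb'
    by (auto simp: lie_def intro!: exI[of _ "\<bar>c\<bar> / m"])
qed

theorem mainTheorem5:
  fixes w :: int and r :: nat and h :: "int \<Rightarrow> nat"
    and Q :: "real ^ 'n ^ 'n"
    and F :: "int \<Rightarrow> (complex ^ 'n) set"
    and N Nm H Np :: "nat \<Rightarrow> real ^ 'n ^ 'n"
    and g :: "nat \<Rightarrow> (nat \<Rightarrow> real) \<Rightarrow> real ^ 'n ^ 'n"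
  assumes "polarizing_form w Q"
    and "nilpotent_orbit w Q h r N F"
    and "sl2_orbit_data w Q r N F Nm H Np g"
  shows "\<exists>c>0. \<forall>y. ratios_exceed r c y \<longrightarrow>
           associated_sl2_triple w Q h (\<Sum>j=1..r. y j *\<^sub>R N j) F
             (\<Sum>j=1..r. y j *\<^sub>R N j,
              \<Sum>j=1..r. H j,
              Ad (g_prod g y (r - 1)) (\<Sum>j=1..r. (1 / y j) *\<^sub>R Np j))"
proof -
  let ?H = "\<Sum>j=1..r. H j" and ?W = "shifted_weight w (partial_sum N r)"
  have r: "1 \<le> r"
    using assms(2) by (simp add: nilpotent_orbit_def)
  \<comment> \<open>This is the top index j = r of the orbit data, where the filtration is F
    itself.\<close>
  obtain Fh where can: "canonical_splitting F ?W Fh" and wg: "weight_grading w Fh ?W ?H"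
    using assms(3) r unfolding sl2_orbit_data_def partial_sum_def
    by (metis atLeastAtMost_iff order_refl)
  have gr: "graded_by (cmat ?H) (\<lambda>k. ?W (k + w))"
    using can wg by (intro graded_by_weight_grading)
      (auto simp: canonical_splitting_def splits_over_reals_def)
  have "\<forall>j\<in>{1..r}. {Nm j, H j, Np j} \<subseteq> g_real Q \<and> sl2_triple (Nm j) (H j) (Np j)"
    using assms(3) unfolding sl2_orbit_data_def by (elim conjE)
  moreover have "\<forall>j\<in>{1..r}. \<forall>k\<in>{1..r}. j \<noteq> k \<longrightarrow>
      (\<forall>X\<in>{Nm j, H j, Np j}. \<forall>Y\<in>{Nm k, H k, Np k}. lie X Y = 0)"
    using assms(3) unfolding sl2_orbit_data_def by (elim conjE)
  ultimately have triples: "\<And>j. j \<in> {1..r} \<Longrightarrow> {Nm j, H j, Np j} \<subseteq> g_real Q"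
    "\<And>j. j \<in> {1..r} \<Longrightarrow> sl2_triple (Nm j) (H j) (Np j)"
    and comm: "\<And>j k A B. j \<in> {1..r} \<Longrightarrow> k \<in> {1..r} \<Longrightarrow> j \<noteq> k \<Longrightarrow> A \<in> {Nm j, H j, Np j} \<Longrightarrow>
      B \<in> {Nm k, H k, Np k} \<Longrightarrow> lie A B = 0"
    by meson+
  have "\<exists>c>0. \<forall>y. ratios_exceed r c y \<longrightarrow>
        (\<forall>j\<in>{1..<r}. g j (\<lambda>k\<in>{1..j}. y k / y (j + 1)) \<in> G_real Q) \<and>
        g_prod g y (r - 1) ** partial_sum H r = partial_sum H r ** g_prod g y (r - 1) \<and>
        (\<Sum>j=1..r. y j *\<^sub>R N j) = Ad (g_prod g y (r - 1)) (\<Sum>j=1..r. y j *\<^sub>R Nm j)"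
    using assms(3) unfolding sl2_orbit_data_def by (elim conjE)
  then obtain c where "c > 0" and c: "\<And>y. ratios_exceed r c y \<Longrightarrow>
        (\<forall>j\<in>{1..<r}. g j (\<lambda>k\<in>{1..j}. y k / y (j + 1)) \<in> G_real Q) \<and>
        g_prod g y (r - 1) ** partial_sum H r = partial_sum H r ** g_prod g y (r - 1) \<and>
        (\<Sum>j=1..r. y j *\<^sub>R N j) = Ad (g_prod g y (r - 1)) (\<Sum>j=1..r. y j *\<^sub>R Nm j)"
    by meson
  have "associated_sl2_triple w Q h (\<Sum>j=1..r. y j *\<^sub>R N j) F
      (\<Sum>j=1..r. y j *\<^sub>R N j, ?H, Ad (g_prod g y (r - 1)) (\<Sum>j=1..r. (1 / y j) *\<^sub>R Np j))"
    if y: "ratios_exceed r c y" for y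
  proof -
    let ?N = "\<Sum>j=1..r. y j *\<^sub>R N j" and ?g = "g_prod g y (r - 1)"
    let ?X = "Ad ?g (\<Sum>j=1..r. (1 / y j) *\<^sub>R Np j)"
    have pos: "0 < y j" if "j \<in> {1..r}" for j
      using ratios_exceed_pos[OF y _ that] \<open>c > 0\<close> by simp
    have G: "?g \<in> G_real Q"
      using c[OF y] by (intro g_prod_in_G_real) auto
    then have inv: "invertible ?g"
      by (simp add: G_real_def)
    have HAd: "Ad ?g ?H = ?H"
      using c[OF y] by (intro Ad_fixed inv) (simp add: partial_sum_def)
    have NAd: "?N = Ad ?g (\<Sum>j=1..r. y j *\<^sub>R Nm j)"
      using c[OF y] by blast
    have "sl2_triple (\<Sum>j=1..r. y j *\<^sub>R Nm j) ?H (\<Sum>j=1..r. (1 / y j) *\<^sub>R Np j)"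
    proof (rule sl2_triple_sum)
      show "y j \<noteq> 0" if "j \<in> {1..r}" for j
        using pos[OF that] by simp
      show "lie A B = 0" if "j \<in> {1..r}" "k \<in> {1..r}" "j \<noteq> k" "A \<in> {Nm j, H j, Np j}"
        "B \<in> {Nm k, H k, Np k}" for j k A B
        by (rule comm[OF that])
    qed (simp_all add: triples(2))
    from sl2_triple_Ad[OF inv this] have sl2: "sl2_triple ?N ?H ?X"
      using HAd NAd by simp
    have mwf: "is_monodromy_weight_filtration (cmat ?N) (\<lambda>k. ?W (k + w))"
      by (rule mwf_of_sl2_triple[OF complex_sl2_triple_cmat[OF sl2] gr])
    \<comment> \<open>The shift by \<open>w\<close> cancels the recentring in
      \<open>shifted_weight\<close>, so the two filtrations are literally equal and
      \<open>can\<close> and \<open>wg\<close> carry over unchanged.\<close>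
    have W: "shifted_weight w ?N = ?W"
      by (rule ext) (simp only: shifted_weight_def[of w ?N] monodromy_weight_filtration_eqI[OF mwf]
          diff_add_cancel)
    have "nilpotent_orbit w Q h 1 (\<lambda>_. ?N) F"
      using nilpotent_orbit_cone[OF assms(2) pos mnilpotent_cmat[OF mwf_nilpotent[OF mwf]]] .
    moreover have "?N \<in> g_real Q"
      using assms(2) by (intro g_real_sum g_real_scaleR) (simp add: nilpotent_orbit_def)
    moreover have "?H \<in> g_real Q"
      using triples(1) by (intro g_real_sum) auto
    moreover have "?X \<in> g_real Q"
      using triples(1) by (intro g_real_Ad G g_real_sum g_real_scaleR) auto
    ultimately show ?thesis
      using sl2 can wg unfolding associated_sl2_triple_def W by auto
  qed
  then show ?thesis
    using \<open>c > 0\<close> by blast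
qed

end
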